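(* Let $X$ be a second countable compact Hausdorff space, $T:X\to X$ a surjective local homeomorphism and $g\in C(X,\mathbf{R}_+^* )$. Let $\mathcal L_g:C(X)\to C(X)$ be the transfer operator $$\mathcal L_g(f)(x)=\sum_{Ty=x}g(y)f(y),$$ with transpose $\mathcal L_g^*:C(X)^*\to C(X)^*$. Assume that the restriction $D$ to $R(X,T)$ of the cocycle $D_g$ on $G(X,T)$ defined by $g$ is uniquely ergodic. Then the eigenvalue problem $$\mathcal L_g^*\mu=\lambda\mu,$$ where $\mu$ is a probability measure on $X$ (and $\lambda$ is a scalar), admits one and only one solution $\mu$.
   Context: $\mathbf{R}_+^*=(0,\infty)$, $\mathbf N=\{0,1,2,\dots\}$; $C(X)$ is the space of real-valued continuous functions, and probability measures are viewed as elements of $C(X)^*$. $G(X,T)=\{(x,m-n,y)\in X\times\mathbf Z\times X: m,n\in\mathbf N,\ T^mx=T^ny\}$, and $D_g(x,m-n,y)=\prod_{i=0}^{m-1}g(T^ix)/\prod_{j=0}^{n-1}g(T^jy)$ when $T^mx=T^ny$. $R(X,T)=\{(x,y)\in X\times X:\exists n\in\mathbf N,\ T^nx=T^ny\}$ is viewed as the subgroupoid of elements $(x,0,y)$; thus $D(x,y)=\prod_{j=0}^{n-1}g(T^jx)/\prod_{j=0}^{n-1}g(T^jy)$ if $T^nx=T^ny$. $R_n=\{(x,y):T^nx=T^ny\}$ has the relative product topology and $R=R(X,T)=\bigcup_nR_n$ has the inductive limit topology ($W$ open iff $W\cap R_n$ open in $R_n$ for all $n$). A probability measure $\mu$ on $X$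 is quasi-invariant under $R$ with Radon-Nikodym derivative $D$ iff $\int\sum_{y:(x,y)\in R}f(x,y)\,d\mu(x)=\int\sum_{x:(x,y)\in R}f(x,y)D(x,y)\,d\mu(y)$ for all $f\in C_c(R)$. $D$ is uniquely ergodic if there is exactly one such probability measure. *)

theory Defs
  imports "HOL-Analysis.Analysis" "HOL-Probability.Probability"
begin

section \<open>Local homeomorphisms\<close>

definition local_homeo :: "('a::topological_space \<Rightarrow> 'b::topological_space) \<Rightarrow> bool" where
  "local_homeo T \<longleftrightarrow>
     (\<forall>x. \<exists>U S. open U \<and> x \<in> U \<and> open (T ` U) \<and> homeomorphism U (T ` U) T S)"

lemma local_homeo_continuous:
  fixes T :: "'a::t2_space \<Rightarrow> 'b::t2_space"
  assumes "local_homeo T"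
  shows "continuous_on UNIV T"
proof -
  have "isCont T x" for x
  proof -
    obtain U S where "open U" "x \<in> U" "homeomorphism U (T ` U) T S"
      using assms unfolding local_homeo_def by blast
    then show ?thesis
      using continuous_on_eq_continuous_at homeomorphism_def by metis
  qed
  then show ?thesis by (simp add: continuous_on_eq_continuous_at)
qed

lemma local_homeo_finite_fibre:
  fixes T :: "'a::t2_space \<Rightarrow> 'b::t2_space"
  assumes T: "local_homeo T" and K: "compact (UNIV :: 'a set)"
  shows "finite {y. T y = x}"
proof -
  have cl: "closed {y. T y = x}"
    using local_homeo_continuous[OF T] by (intro closed_Collect_eq) auto
  then have cpt: "compact {y. T y = x}"
    using compact_Int_closed[OF K] by simp
  have "\<exists>U. open U \<and> y \<in> U \<and> U \<inter> {y. T y = x} \<subseteq> {y}" if "T y = x" for y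
  proof -
    obtain U S where "open U" "y \<in> U" "homeomorphism U (T ` U) T S"
      using T unfolding local_homeo_def by blast
    moreover have "inj_on T U"
      using \<open>homeomorphism U (T ` U) T S\<close> unfolding homeomorphism_def
      by (metis inj_on_inverseI)
    ultimately show ?thesis using that inj_onD[of T U] by (intro exI[of _ U]) auto
  qed
  then obtain U where U: "\<And>y. T y = x \<Longrightarrow> open (U y) \<and> y \<in> U y \<and> U y \<inter> {y. T y = x} \<subseteq> {y}"
    by metis
  have cover: "{y. T y = x} \<subseteq> (\<Union>y\<in>{y. T y = x}. U y)" using U by auto
  obtain D where D: "D \<subseteq> {y. T y = x}" "finite D" "{y. T y = x} \<subseteq> (\<Union>y\<in>D. U y)"
    by (rule compactE_image[OF cpt _ cover]) (use U in simp, blast)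
  have "{y. T y = x} \<subseteq> D"
  proof
    fix z assume z: "z \<in> {y. T y = x}"
    then obtain y where y: "y \<in> D" "z \<in> U y" using D(3) by auto
    then have "T y = x" using D(1) by auto
    then have "U y \<inter> {y. T y = x} \<subseteq> {y}" using U by simp
    then have "z = y" using z y(2) by auto
    then show "z \<in> D" using y(1) by simp
  qed
  then show ?thesis using D finite_subset by blast
qed

lemma continuous_on_fibre_sum:
  fixes T :: "'a::t2_space \<Rightarrow> 'b::t2_space" and h :: "'a \<Rightarrow> real"
  assumes T: "local_homeo T" and K: "compact (UNIV :: 'a set)" and h: "continuous_on UNIV h"
  shows "continuous_on UNIV (\<lambda>x. \<Sum>y | T y = x. h y)"
proof -
  have "isCont (\<lambda>x. \<Sum>y | T y = x. h y) x" for x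
  proof -
    define F where "F = {y. T y = x}"
    have fin: "finite F" unfolding F_def by (rule local_homeo_finite_fibre[OF T K])
    obtain U S where US: "\<And>y. open (U y)" "\<And>y. y \<in> U y" "\<And>y. open (T ` U y)"
        "\<And>y. homeomorphism (U y) (T ` U y) T (S y)"
      using T unfolding local_homeo_def by metis
    have S_lim: "(S y \<longlongrightarrow> y) (nhds x)" if "y \<in> F" for y
    proof -
      have x: "x \<in> T ` U y" "S y x = y"
        using US(2,4)[of y] that unfolding F_def homeomorphism_def by auto
      have "continuous_on (T ` U y) (S y)" using US(4) homeomorphism_def by blast
      then have "isCont (S y) x"
        using US(3)[of y] x(1) continuous_on_eq_continuous_at by blast
      then have "(S y \<longlongrightarrow> S y x) (nhds x)"
        unfolding continuous_at tendsto_at_iff_tendsto_nhds .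
      then show ?thesis using x(2) by simp
    qed
    have ev_img: "\<forall>\<^sub>F z in nhds x. \<forall>y\<in>F. z \<in> T ` U y"
      using US F_def fin
      by (intro eventually_ball_finite ballI eventually_nhds_in_open) auto
    have ev_cover: "\<forall>\<^sub>F z in nhds x. \<forall>w. T w = z \<longrightarrow> (\<exists>y\<in>F. w \<in> U y)"
    proof -
      let ?C = "UNIV - (\<Union>y\<in>F. U y)"
      have "closed ?C" using US by (simp add: closed_def open_UN Diff_Diff_Int)
      then have "compact ?C" using compact_Int_closed[OF K] by simp
      then have "compact (T ` ?C)"
        using local_homeo_continuous[OF T] compact_continuous_image continuous_on_subset
        by (metis subset_UNIV)
      then have "open (- (T ` ?C))" using compact_imp_closed by blast
      moreover have "x \<in> - (T ` ?C)" using US F_def by auto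
      ultimately have "\<forall>\<^sub>F z in nhds x. z \<in> - (T ` ?C)"
        by (rule eventually_nhds_in_open)
      then show ?thesis by eventually_elim blast
    qed
    have ev_sep: "\<forall>\<^sub>F z in nhds x. \<forall>y\<in>F. \<forall>y'\<in>F. y \<noteq> y' \<longrightarrow> S y z \<noteq> S y' z"
    proof (intro eventually_ball_finite ballI fin)
      fix y y' assume yy: "y \<in> F" "y' \<in> F"
      show "\<forall>\<^sub>F z in nhds x. y \<noteq> y' \<longrightarrow> S y z \<noteq> S y' z"
      proof (cases "y = y'")
        case False
        then obtain A B where AB: "open A" "open B" "y \<in> A" "y' \<in> B" "A \<inter> B = {}"
          using hausdorff by metis
        have "\<forall>\<^sub>F z in nhds x. S y z \<in> A" "\<forall>\<^sub>F z in nhds x. S y' z \<in> B"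
          using S_lim yy AB topological_tendstoD by blast+
        then show ?thesis by eventually_elim (use AB in auto)
      qed simp
    qed
    have ev_eq: "\<forall>\<^sub>F z in nhds x. (\<Sum>y\<in>F. h (S y z)) = (\<Sum>y | T y = z. h y)"
      using ev_img ev_cover ev_sep
    proof eventually_elim
      case (elim z)
      have inj: "inj_on (\<lambda>y. S y z) F" using elim(3) by (auto simp: inj_on_def)
      have "(\<lambda>y. S y z) ` F = {y. T y = z}"
      proof (intro equalityI subsetI)
        fix w assume "w \<in> (\<lambda>y. S y z) ` F"
        then obtain y where "y \<in> F" "w = S y z" by blast
        then show "w \<in> {y. T y = z}"
          using elim(1) US(4)[of y] unfolding homeomorphism_def by auto
      next
        fix w assume w: "w \<in> {y. T y = z}"
        then obtain y where "y \<in> F" "w \<in> U y" using elim(2) by blast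
        then show "w \<in> (\<lambda>y. S y z) ` F"
          using US(4)[of y] w unfolding homeomorphism_def by force
      qed
      then have "bij_betw (\<lambda>y. S y z) F {y. T y = z}"
        using inj by (simp add: bij_betw_def)
      then show ?case by (rule sum.reindex_bij_betw)
    qed
    have "((\<lambda>z. \<Sum>y\<in>F. h (S y z)) \<longlongrightarrow> (\<Sum>y\<in>F. h y)) (nhds x)"
    proof (intro tendsto_sum)
      fix y assume "y \<in> F"
      have "isCont h y" using h by (simp add: continuous_on_eq_continuous_at)
      then have "(h \<longlongrightarrow> h y) (nhds y)" by (simp add: continuous_at tendsto_at_iff_tendsto_nhds)
      then show "((\<lambda>z. h (S y z)) \<longlongrightarrow> h y) (nhds x)"
        using S_lim[OF \<open>y \<in> F\<close>] by (rule filterlim_compose)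
    qed
    then have "((\<lambda>z. \<Sum>y | T y = z. h y) \<longlongrightarrow> (\<Sum>y\<in>F. h y)) (nhds x)"
      using ev_eq by (rule Lim_transform_eventually)
    then show ?thesis
      unfolding isCont_def F_def using at_within_le_nhds tendsto_mono by blast
  qed
  then show ?thesis by (simp add: continuous_on_eq_continuous_at)
qed


section \<open>The transfer operator and its transpose\<close>

text \<open>On a compact space every continuous function is bounded, so the Banach space
  \<open>C(X)\<close> is the type \<open>'a \<Rightarrow>\<^sub>C real\<close> and its dual is \<open>('a \<Rightarrow>\<^sub>C real) \<Rightarrow>\<^sub>L real\<close>.
  \<open>Bcontfun\<close> and \<open>Blinfun\<close> are meaningful only on bounded continuous functions and bounded
  linear maps; the lemmas \<open>transfer_op_apply\<close> and \<open>prob_functional_apply\<close> below discharge this.\<close>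

definition transfer_op ::
    "('a::topological_space \<Rightarrow> 'a) \<Rightarrow> ('a \<Rightarrow> real) \<Rightarrow> ('a \<Rightarrow>\<^sub>C real) \<Rightarrow>\<^sub>L ('a \<Rightarrow>\<^sub>C real)" where
  "transfer_op T g = Blinfun (\<lambda>f. Bcontfun (\<lambda>x. \<Sum>y | T y = x. g y * apply_bcontfun f y))"

definition transpose_op ::
    "('v::real_normed_vector \<Rightarrow>\<^sub>L 'w::real_normed_vector) \<Rightarrow> ('w \<Rightarrow>\<^sub>L real) \<Rightarrow> ('v \<Rightarrow>\<^sub>L real)" where
  "transpose_op A \<phi> = \<phi> o\<^sub>L A"

definition is_borel_prob :: "'a::topological_space measure \<Rightarrow> bool" where
  "is_borel_prob \<mu> \<longleftrightarrow> sets \<mu> = sets borel \<and> prob_space \<mu>"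

definition prob_functional :: "'a::topological_space measure \<Rightarrow> ('a \<Rightarrow>\<^sub>C real) \<Rightarrow>\<^sub>L real" where
  "prob_functional \<mu> = Blinfun (\<lambda>f. \<integral>x. apply_bcontfun f x \<partial>\<mu>)"

lemma transfer_op_apply:
  fixes T :: "'a::t2_space \<Rightarrow> 'a"
  assumes T: "local_homeo T" and K: "compact (UNIV :: 'a set)" and g: "continuous_on UNIV g"
  shows "apply_bcontfun (blinfun_apply (transfer_op T g) f) x
           = (\<Sum>y | T y = x. g y * apply_bcontfun f y)"
proof -
  let ?L = "\<lambda>f x. \<Sum>y | T y = x. g y * apply_bcontfun f y"
  have bc: "u \<in> bcontfun" if "continuous_on UNIV u" for u :: "'a \<Rightarrow> real"
    using that compact_imp_bounded[OF compact_continuous_image[OF that K]]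
    by (simp add: bcontfun_def)
  have cont: "continuous_on UNIV (?L f)" for f :: "'a \<Rightarrow>\<^sub>C real"
    by (intro continuous_on_fibre_sum[OF T K] continuous_intros g) simp
  have app: "apply_bcontfun (Bcontfun (?L f)) = ?L f" for f :: "'a \<Rightarrow>\<^sub>C real"
    by (rule Bcontfun_inverse[OF bc[OF cont]])
  have "continuous_on UNIV (\<lambda>x. \<Sum>y | T y = x. \<bar>g y\<bar>)"
    by (intro continuous_on_fibre_sum[OF T K] continuous_intros g)
  then have "bounded (range (\<lambda>x. \<Sum>y | T y = x. \<bar>g y\<bar>))"
    using bc by (simp add: bcontfun_def)
  then obtain B where B: "\<And>x. \<bar>\<Sum>y | T y = x. \<bar>g y\<bar>\<bar> \<le> B"
    unfolding bounded_iff by auto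
  have "bounded_linear (\<lambda>f. Bcontfun (?L f))"
  proof (rule bounded_linear_intro[where K = B])
    fix f :: "'a \<Rightarrow>\<^sub>C real"
    show "norm (Bcontfun (?L f)) \<le> norm f * B"
    proof (rule norm_bound)
      fix x
      have "\<bar>?L f x\<bar> \<le> (\<Sum>y | T y = x. \<bar>g y\<bar> * norm f)"
        using norm_bounded[of f]
        by (intro order_trans[OF sum_abs] sum_mono) (auto simp: abs_mult intro!: mult_left_mono)
      also have "\<dots> = norm f * (\<Sum>y | T y = x. \<bar>g y\<bar>)"
        by (simp add: sum_distrib_left mult.commute)
      also have "\<dots> \<le> norm f * B"
        using B[of x] by (intro mult_left_mono) auto
      finally show "norm (apply_bcontfun (Bcontfun (?L f)) x) \<le> norm f * B"
        by (simp add: app)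
    qed
  next
    fix f h :: "'a \<Rightarrow>\<^sub>C real"
    have "?L (f + h) x = ?L f x + ?L h x" for x
      by (simp add: plus_bcontfun.rep_eq distrib_left sum.distrib)
    then show "Bcontfun (?L (f + h)) = Bcontfun (?L f) + Bcontfun (?L h)"
      by (intro bcontfun_eqI) (subst plus_bcontfun.rep_eq, subst (1 2 3) app, assumption)
  next
    fix r :: real and f :: "'a \<Rightarrow>\<^sub>C real"
    have "?L (r *\<^sub>R f) x = r *\<^sub>R ?L f x" for x
      by (simp add: scaleR_bcontfun.rep_eq sum_distrib_left mult.left_commute)
    then show "Bcontfun (?L (r *\<^sub>R f)) = r *\<^sub>R Bcontfun (?L f)"
      by (intro bcontfun_eqI) (subst scaleR_bcontfun.rep_eq, subst (1 2) app, assumption)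
  qed
  then show ?thesis
    unfolding transfer_op_def by (simp add: bounded_linear_Blinfun_apply app)
qed

lemma prob_functional_apply:
  assumes "is_borel_prob \<mu>"
  shows "blinfun_apply (prob_functional \<mu>) f = (\<integral>x. apply_bcontfun f x \<partial>\<mu>)"
proof -
  interpret prob_space \<mu> using assms by (simp add: is_borel_prob_def)
  have int: "integrable \<mu> (apply_bcontfun f)" for f :: "'a \<Rightarrow>\<^sub>C real"
  proof (rule integrable_const_bound[where B = "norm f"])
    show "AE x in \<mu>. norm (apply_bcontfun f x) \<le> norm f"
      using norm_bounded[of f] by simp
    have "apply_bcontfun f \<in> borel_measurable borel"
      by (intro borel_measurable_continuous_onI) simp
    then show "apply_bcontfun f \<in> borel_measurable \<mu>"
      using assms measurable_cong_sets unfolding is_borel_prob_def by blast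
  qed
  have "bounded_linear (\<lambda>f :: 'a \<Rightarrow>\<^sub>C real. \<integral>x. apply_bcontfun f x \<partial>\<mu>)"
  proof (rule bounded_linear_intro[where K = 1])
    fix f :: "'a \<Rightarrow>\<^sub>C real"
    have "norm (\<integral>x. apply_bcontfun f x \<partial>\<mu>) \<le> (\<integral>x. norm (apply_bcontfun f x) \<partial>\<mu>)"
      by (rule integral_norm_bound)
    also have "\<dots> \<le> (\<integral>x. norm f \<partial>\<mu>)"
      using int norm_bounded[of f] by (intro integral_mono) auto
    finally show "norm (\<integral>x. apply_bcontfun f x \<partial>\<mu>) \<le> norm f * 1"
      by (simp add: prob_space)
  qed (simp_all add: int plus_bcontfun.rep_eq scaleR_bcontfun.rep_eq)
  then show ?thesis
    unfolding prob_functional_def by (simp add: bounded_linear_Blinfun_apply)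
qed


section \<open>The groupoid of \<open>T\<close> and the cocycle defined by \<open>g\<close>\<close>

definition dr_groupoid :: "('a \<Rightarrow> 'a) \<Rightarrow> ('a \<times> int \<times> 'a) set" where
  "dr_groupoid T = {(x, int m - int n, y) | x m n y. (T ^^ m) x = (T ^^ n) y}"

text \<open>The value does not depend on the choice of \<open>(m, n)\<close> representing \<open>k\<close>; see
  \<open>dr_cocycle_eq\<close>. Off \<open>dr_groupoid T\<close> the value is irrelevant.\<close>

definition dr_cocycle :: "('a \<Rightarrow> 'a) \<Rightarrow> ('a \<Rightarrow> real) \<Rightarrow> 'a \<times> int \<times> 'a \<Rightarrow> real" where
  "dr_cocycle T g = (\<lambda>(x, k, y). THE r. \<exists>m n. k = int m - int n \<and> (T ^^ m) x = (T ^^ n) y \<and>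
     r = (\<Prod>i<m. g ((T ^^ i) x)) / (\<Prod>j<n. g ((T ^^ j) y)))"

definition tail_rel_level :: "('a \<Rightarrow> 'a) \<Rightarrow> nat \<Rightarrow> ('a \<times> 'a) set" where
  "tail_rel_level T n = {(x, y). (T ^^ n) x = (T ^^ n) y}"

definition tail_rel :: "('a \<Rightarrow> 'a) \<Rightarrow> ('a \<times> 'a) set" where
  "tail_rel T = (\<Union>n. tail_rel_level T n)"

definition tail_cocycle :: "('a \<Rightarrow> 'a) \<Rightarrow> ('a \<Rightarrow> real) \<Rightarrow> 'a \<times> 'a \<Rightarrow> real" where
  "tail_cocycle T g = (\<lambda>(x, y). dr_cocycle T g (x, 0, y))"

lemma tail_rel_iff_groupoid: "(x, y) \<in> tail_rel T \<longleftrightarrow> (x, 0, y) \<in> dr_groupoid T"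
  unfolding tail_rel_def tail_rel_level_def dr_groupoid_def by auto

lemma dr_cocycle_eq:
  assumes g: "\<And>x. g x \<noteq> 0" and eq: "(T ^^ m) x = (T ^^ n) y"
  shows "dr_cocycle T g (x, int m - int n, y)
           = (\<Prod>i<m. g ((T ^^ i) x)) / (\<Prod>j<n. g ((T ^^ j) y))"
proof -
  let ?q = "\<lambda>m n. (\<Prod>i<m. g ((T ^^ i) x)) / (\<Prod>j<n. g ((T ^^ j) y))"
  have shift: "?q (m + p) (n + p) = ?q m n" if "(T ^^ m) x = (T ^^ n) y" for m n p
  proof (induction p)
    case (Suc p)
    have "(T ^^ (m + p)) x = (T ^^ (n + p)) y"
      using that by (metis add.commute comp_apply funpow_add)
    then show ?case using Suc g by simp
  qed simp
  have "?q m' n' = ?q m n"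
    if "int m - int n = int m' - int n'" "(T ^^ m') x = (T ^^ n') y" for m' n'
  proof (cases "m \<le> m'")
    case True
    then have "m' = m + (m' - m)" "n' = n + (m' - m)" using that(1) by auto
    then show ?thesis using shift[OF eq, of "m' - m"] by metis
  next
    case False
    then have "m = m' + (m - m')" "n = n' + (m - m')" using that(1) by auto
    then show ?thesis using shift[OF that(2), of "m - m'"] by metis
  qed
  then show ?thesis
    unfolding dr_cocycle_def prod.case using eq by (intro the_equality) blast+
qed

lemma tail_cocycle_eq:
  assumes "\<And>x. g x \<noteq> 0" and "(T ^^ n) x = (T ^^ n) y"
  shows "tail_cocycle T g (x, y) = (\<Prod>j<n. g ((T ^^ j) x)) / (\<Prod>j<n. g ((T ^^ j) y))"
  using dr_cocycle_eq[OF assms] by (simp add: tail_cocycle_def)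


section \<open>Quasi-invariant measures and unique ergodicity\<close>

definition tail_topology :: "('a::topological_space \<Rightarrow> 'a) \<Rightarrow> ('a \<times> 'a) topology" where
  "tail_topology T = topology (\<lambda>W. W \<subseteq> tail_rel T \<and>
     (\<forall>n. openin (top_of_set (tail_rel_level T n)) (W \<inter> tail_rel_level T n)))"

lemma openin_tail_topology:
  "openin (tail_topology T) W \<longleftrightarrow> W \<subseteq> tail_rel T \<and>
     (\<forall>n. openin (top_of_set (tail_rel_level T n)) (W \<inter> tail_rel_level T n))"
proof -
  let ?lev = "\<lambda>n. top_of_set (tail_rel_level T n)"
  let ?open = "\<lambda>W. W \<subseteq> tail_rel T \<and> (\<forall>n. openin (?lev n) (W \<inter> tail_rel_level T n))"
  have "istopology ?open"
    unfolding istopology_def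
  proof (intro conjI allI impI)
    fix V W
    assume VW: "?open V" "?open W"
    show "V \<inter> W \<subseteq> tail_rel T" using VW by blast
    fix n
    have "openin (?lev n) ((V \<inter> tail_rel_level T n) \<inter> (W \<inter> tail_rel_level T n))"
      using VW by (intro openin_Int[of "?lev n" "V \<inter> tail_rel_level T n"]) blast+
    moreover have "(V \<inter> tail_rel_level T n) \<inter> (W \<inter> tail_rel_level T n) = V \<inter> W \<inter> tail_rel_level T n"
      by blast
    ultimately show "openin (?lev n) (V \<inter> W \<inter> tail_rel_level T n)" by metis
  next
    fix \<K>
    assume K: "\<forall>W\<in>\<K>. ?open W"
    show "\<Union>\<K> \<subseteq> tail_rel T" using K by blast
    fix n
    have "openin (?lev n) (\<Union>W\<in>\<K>. W \<inter> tail_rel_level T n)"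
      using K by (intro openin_Union) blast
    then show "openin (?lev n) (\<Union>\<K> \<inter> tail_rel_level T n)"
      by (simp only: Int_Union2)
  qed
  then show ?thesis unfolding tail_topology_def by (rule topology_inverse'[THEN fun_cong])
qed

lemma topspace_tail_topology: "topspace (tail_topology T) = tail_rel T"
proof -
  have "openin (tail_topology T) (tail_rel T)"
    unfolding openin_tail_topology tail_rel_def
    by (auto simp: Int_absorb1 UN_upper)
  then show ?thesis
    using openin_tail_topology[of T "topspace (tail_topology T)"] openin_subset
    by (intro subset_antisym) auto
qed

definition tail_Cc :: "('a::topological_space \<Rightarrow> 'a) \<Rightarrow> ('a \<times> 'a \<Rightarrow> real) set" where
  "tail_Cc T = {f. continuous_map (tail_topology T) euclideanreal f \<and>
     compactin (tail_topology T) (tail_topology T closure_of {p \<in> tail_rel T. f p \<noteq> 0})}"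

text \<open>The classes of \<open>tail_rel T\<close> may be infinite, so that \<open>sum\<close> would return \<open>0\<close>; hence the
  unordered sums \<open>infsum\<close>, which have only finitely many nonzero terms when \<open>T\<close> is a local
  homeomorphism of a compact space.\<close>

definition quasi_invariant ::
    "('a::topological_space \<Rightarrow> 'a) \<Rightarrow> ('a \<times> 'a \<Rightarrow> real) \<Rightarrow> 'a measure \<Rightarrow> bool" where
  "quasi_invariant T D \<mu> \<longleftrightarrow> (\<forall>f\<in>tail_Cc T.
     (\<integral>x. (\<Sum>\<^sub>\<infinity>y\<in>{y. (x, y) \<in> tail_rel T}. f (x, y)) \<partial>\<mu>) =
     (\<integral>y. (\<Sum>\<^sub>\<infinity>x\<in>{x. (x, y) \<in> tail_rel T}. f (x, y) * D (x, y)) \<partial>\<mu>))"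

definition uniquely_ergodic ::
    "('a::topological_space \<Rightarrow> 'a) \<Rightarrow> ('a \<times> 'a \<Rightarrow> real) \<Rightarrow> bool" where
  "uniquely_ergodic T D \<longleftrightarrow> (\<exists>!\<mu>. is_borel_prob \<mu> \<and> quasi_invariant T D \<mu>)"

end

(* Let \<mu> be quasi-invariant with derivative D. Testing on the clopen subsets R_n of R shows that
   this means exactly: for every n, \<integral>u d\<mu> depends only on L_g^n u. An eigenmeasure has this property,
   because \<integral>L_g^n u d\<mu> = c^n \<integral>u d\<mu> with c \<noteq> 0; this gives uniqueness. Conversely, if \<mu> has the
   property, then so does the normalization of (1 / L_g 1) T_*\<mu>, because
   L_g^{n+1}((u / L_g 1) \<circ> T) = L_g^n u. By unique ergodicity it equals \<mu>, and this identity
   is the eigenvalue equation, since L_g((L_g u / L_g 1) \<circ> T) = L_g u. *)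
theory Submission
  imports Defs
begin

section \<open>Local homeomorphisms\<close>

text \<open>The right-hand side mentions no local inverses, so stability under composition and
  products can be checked directly. An open set has open image because it is a union of pieces
  inside the sets \<open>U x\<close>; conversely, a continuous open map is a homeomorphism from any
  set \<open>U\<close> on which it is injective onto the image of \<open>U\<close>.\<close>

lemma local_homeo_iff:
  fixes T :: "'a::t2_space \<Rightarrow> 'b::t2_space"
  shows "local_homeo T \<longleftrightarrow> continuous_on UNIV T \<and> (\<forall>A. open A \<longrightarrow> open (T ` A)) \<and>
    (\<forall>x. \<exists>U. open U \<and> x \<in> U \<and> inj_on T U)" (is "_ \<longleftrightarrow> ?C \<and> ?O \<and> ?I")
proof (intro iffI conjI)
  assume T: "local_homeo T"
  show ?C by (rule local_homeo_continuous[OF T])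
  obtain U S where US: "\<And>x. open (U x)" "\<And>x. x \<in> U x" "\<And>x. open (T ` U x)"
      "\<And>x. homeomorphism (U x) (T ` U x) T (S x)"
    using T unfolding local_homeo_def by metis
  show ?I
    using US unfolding homeomorphism_def by (metis inj_on_inverseI)
  show ?O
  proof (intro allI impI)
    fix A :: "'a set" assume A: "open A"
    have "open (T ` (A \<inter> U x))" for x
    proof -
      have "openin (top_of_set (U x)) (A \<inter> U x)"
        using openin_open_Int[OF A] by (metis inf_commute)
      then have "openin (top_of_set (T ` U x)) (T ` (A \<inter> U x))"
        by (rule homeomorphism_imp_open_map[OF US(4)])
      then show ?thesis using US(3) openin_open_eq by blast
    qed
    then have "open (\<Union>x. T ` (A \<inter> U x))" by blast
    also have "(\<Union>x. T ` (A \<inter> U x)) = T ` A" using US(2) by blast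
    finally show "open (T ` A)" .
  qed
next
  assume *: "?C \<and> ?O \<and> ?I"
  show "local_homeo T"
    unfolding local_homeo_def
  proof
    fix x
    obtain U where U: "open U" "x \<in> U" "inj_on T U" using * by blast
    have "openin (top_of_set (T ` U)) (T ` V)" if "openin (top_of_set U) V" for V
      using that U(1) * by (metis image_mono open_openin openin_open_eq openin_imp_subset openin_subset_trans
          subset_UNIV subtopology_UNIV)
    then obtain S where "homeomorphism U (T ` U) T S"
      using homeomorphism_injective_open_map[of U T "T ` U"] * U continuous_on_subset
      by (metis subset_UNIV)
    then show "\<exists>U S. open U \<and> x \<in> U \<and> open (T ` U) \<and> homeomorphism U (T ` U) T S"
      using U * by blast
  qed
qed

lemma local_homeo_locally_inj:
  fixes T :: "'a::t2_space \<Rightarrow> 'b::t2_space"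
  assumes "local_homeo T"
  obtains U where "open U" "x \<in> U" "inj_on T U"
  using assms unfolding local_homeo_iff by metis

lemma local_homeo_id: "local_homeo (id :: 'a::t2_space \<Rightarrow> 'a)"
  unfolding local_homeo_iff by (auto simp: continuous_on_id')

lemma local_homeo_comp:
  fixes S :: "'b::t2_space \<Rightarrow> 'c::t2_space" and T :: "'a::t2_space \<Rightarrow> 'b"
  assumes S: "local_homeo S" and T: "local_homeo T"
  shows "local_homeo (S \<circ> T)"
  unfolding local_homeo_iff
proof (intro conjI allI impI)
  have cS: "continuous_on UNIV S" and cT: "continuous_on UNIV T"
    using S T by (simp_all add: local_homeo_continuous)
  show "continuous_on UNIV (S \<circ> T)"
    using cT cS by (metis continuous_on_compose continuous_on_subset subset_UNIV)
  show "open ((S \<circ> T) ` A)" if "open A" for A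
    using S T that unfolding local_homeo_iff image_comp[symmetric] by blast
  fix x
  obtain U where U: "open U" "x \<in> U" "inj_on T U" by (rule local_homeo_locally_inj[OF T])
  obtain V where V: "open V" "T x \<in> V" "inj_on S V" by (rule local_homeo_locally_inj[OF S])
  have "open (U \<inter> T -` V)"
    using U V cT by (simp add: open_Int open_vimage)
  moreover have "inj_on (S \<circ> T) (U \<inter> T -` V)"
    using U(3) V(3) by (auto simp: inj_on_def)
  ultimately show "\<exists>U. open U \<and> x \<in> U \<and> inj_on (S \<circ> T) U" using U V by auto
qed

lemma local_homeo_funpow:
  fixes T :: "'a::t2_space \<Rightarrow> 'a"
  assumes "local_homeo T"
  shows "local_homeo (T ^^ n)"
  by (induction n) (simp_all only: funpow.simps local_homeo_id local_homeo_comp[OF assms])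

text \<open>Serves fibre sums with a parameter, where the identity acts on the parameter.\<close>

lemma local_homeo_map_prod:
  fixes S :: "'a::t2_space \<Rightarrow> 'b::t2_space" and T :: "'c::t2_space \<Rightarrow> 'd::t2_space"
  assumes S: "local_homeo S" and T: "local_homeo T"
  shows "local_homeo (map_prod S T)"
  unfolding local_homeo_iff
proof (intro conjI allI impI)
  have cS: "continuous_on UNIV S" and cT: "continuous_on UNIV T"
    using S T by (simp_all add: local_homeo_continuous)
  show "continuous_on UNIV (map_prod S T)"
    unfolding map_prod_def case_prod_beta
    by (intro continuous_on_Pair continuous_on_compose2[OF cS] continuous_on_compose2[OF cT]
        continuous_intros) auto
  show "open (map_prod S T ` A)" if A: "open A" for A
  proof (subst open_subopen, rule ballI)
    fix z assume "z \<in> map_prod S T ` A"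
    then obtain x y where xy: "(x, y) \<in> A" "z = (S x, T y)" by auto
    then obtain B C where BC: "open B" "open C" "x \<in> B" "y \<in> C" "B \<times> C \<subseteq> A"
      using A by (metis mem_Sigma_iff open_prod_elim)
    then have "open (S ` B \<times> T ` C)" using S T by (simp add: local_homeo_iff open_Times)
    moreover have "z \<in> S ` B \<times> T ` C" using xy BC by auto
    moreover have "S ` B \<times> T ` C \<subseteq> map_prod S T ` A"
      using BC(5) by (metis image_mono map_prod_surj_on)
    ultimately show "\<exists>V. open V \<and> z \<in> V \<and> V \<subseteq> map_prod S T ` A" by blast
  qed
  fix p :: "'a \<times> 'c"
  obtain U where U: "open U" "fst p \<in> U" "inj_on S U" by (rule local_homeo_locally_inj[OF S])
  obtain V where V: "open V" "snd p \<in> V" "inj_on T V" by (rule local_homeo_locally_inj[OF T])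
  show "\<exists>U. open U \<and> p \<in> U \<and> inj_on (map_prod S T) U"
    using U V by (intro exI[of _ "U \<times> V"]) (auto simp: open_Times mem_Times_iff inj_on_def)
qed

lemma compact_UNIV_prod:
  assumes "compact (UNIV :: 'a::topological_space set)" and "compact (UNIV :: 'b::topological_space set)"
  shows "compact (UNIV :: ('a \<times> 'b) set)"
  using compact_Times[OF assms] by simp

text \<open>The sum is an ordinary fibre sum of the local homeomorphism
  \<open>map_prod id T\<close>, evaluated along the graph of \<open>u\<close>. With \<open>u\<close>
  and \<open>T\<close> both taken to be \<open>T ^^ n\<close> it covers sums over classes of
  \<open>R_n\<close>.\<close>

lemma continuous_on_fibre_sum_param:
  fixes T :: "'a::t2_space \<Rightarrow> 'b::t2_space" and h :: "'c::t2_space \<times> 'a \<Rightarrow> real"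
  assumes T: "local_homeo T" and K: "compact (UNIV :: 'a set)" "compact (UNIV :: 'c set)"
    and h: "continuous_on UNIV h" and u: "continuous_on UNIV u"
  shows "continuous_on UNIV (\<lambda>x. \<Sum>y | T y = u x. h (x, y))"
proof -
  let ?S = "\<lambda>p. \<Sum>q | map_prod id T q = p. h q"
  have "continuous_on UNIV ?S"
    by (intro continuous_on_fibre_sum local_homeo_map_prod local_homeo_id T h compact_UNIV_prod K)
  then have "continuous_on UNIV (\<lambda>x. ?S (x, u x))"
    by (rule continuous_on_compose2) (auto intro!: continuous_intros u)
  moreover have "?S (x, u x) = (\<Sum>y | T y = u x. h (x, y))" for x
    by (rule sum.reindex_bij_witness[where i = "Pair x" and j = snd]) auto
  ultimately show ?thesis by simp
qed

text \<open>Supplies the normality required by the Tietze extension theorem.\<close>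

lemma normal_space_euclidean_compact:
  assumes "compact (UNIV :: 'a::t2_space set)"
  shows "normal_space (euclidean :: 'a topology)"
proof (rule compact_Hausdorff_or_regular_imp_normal_space)
  show "compact_space (euclidean :: 'a topology)"
    using assms by (simp add: compact_space_def)
  have "Hausdorff_space (euclidean :: 'a topology)"
    unfolding Hausdorff_space_def disjnt_def by (simp add: separation_t2)
  then show "Hausdorff_space (euclidean :: 'a topology) \<or> regular_space (euclidean :: 'a topology)" ..
qed

section \<open>The inductive limit topology\<close>

lemma tail_rel_level_mono: "n \<le> m \<Longrightarrow> tail_rel_level T n \<subseteq> tail_rel_level T m"
  unfolding tail_rel_level_def
  by clarsimp (metis comp_apply funpow_add le_add_diff_inverse2)

lemma tail_rel_level_iff: "(x, y) \<in> tail_rel_level T n \<longleftrightarrow> (T ^^ n) x = (T ^^ n) y"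
  by (simp add: tail_rel_level_def)

lemma tail_rel_level_subset: "tail_rel_level T n \<subseteq> tail_rel T"
  unfolding tail_rel_def by blast

lemma tail_relI: "(T ^^ n) x = (T ^^ n) y \<Longrightarrow> (x, y) \<in> tail_rel T"
  by (auto simp: tail_rel_def tail_rel_level_iff)

lemma closed_tail_rel_level:
  fixes T :: "'a::t2_space \<Rightarrow> 'a"
  assumes "local_homeo T"
  shows "closed (tail_rel_level T n)"
proof -
  have c: "continuous_on UNIV (T ^^ n)"
    by (intro local_homeo_continuous local_homeo_funpow assms)
  have "closed {p. (T ^^ n) (fst p) = (T ^^ n) (snd p)}"
    by (intro closed_Collect_eq continuous_on_compose2[OF c] continuous_intros) auto
  moreover have "tail_rel_level T n = {p. (T ^^ n) (fst p) = (T ^^ n) (snd p)}"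
    by (auto simp: tail_rel_level_def)
  ultimately show ?thesis by simp
qed

text \<open>Local injectivity of \<open>T ^^ (m - n)\<close> is what makes \<open>R\<^sub>n\<close> open in \<open>R\<^sub>m\<close>.\<close>

lemma openin_tail_rel_level_level:
  fixes T :: "'a::t2_space \<Rightarrow> 'a"
  assumes T: "local_homeo T" and "n \<le> m"
  shows "openin (top_of_set (tail_rel_level T m)) (tail_rel_level T n)"
proof -
  define W where "W = \<Union>{U \<times> U | U. open U \<and> inj_on (T ^^ (m - n)) U}"
  have "open W" unfolding W_def by (auto intro: open_Times)
  moreover have c: "continuous_on UNIV (T ^^ n)"
    by (intro local_homeo_continuous local_homeo_funpow T)
  have "continuous_on UNIV (\<lambda>p. ((T ^^ n) (fst p), (T ^^ n) (snd p)))"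
    by (intro continuous_on_Pair continuous_on_compose2[OF c] continuous_intros) auto
  ultimately have "open ((\<lambda>p. ((T ^^ n) (fst p), (T ^^ n) (snd p))) -` W)"
    by (rule open_vimage)
  moreover have "tail_rel_level T n =
      tail_rel_level T m \<inter> (\<lambda>p. ((T ^^ n) (fst p), (T ^^ n) (snd p))) -` W"
  proof (intro equalityI subsetI IntI)
    fix p assume p: "p \<in> tail_rel_level T n"
    show "p \<in> tail_rel_level T m" using p tail_rel_level_mono[OF \<open>n \<le> m\<close>] by blast
    obtain U where "open U" "(T ^^ n) (fst p) \<in> U" "inj_on (T ^^ (m - n)) U"
      by (rule local_homeo_locally_inj[OF local_homeo_funpow[OF T]])
    moreover have "(T ^^ n) (fst p) = (T ^^ n) (snd p)"
      using p by (auto simp: tail_rel_level_def)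
    ultimately show "p \<in> (\<lambda>p. ((T ^^ n) (fst p), (T ^^ n) (snd p))) -` W"
      unfolding W_def by auto
  next
    fix p
    assume p: "p \<in> tail_rel_level T m \<inter> (\<lambda>p. ((T ^^ n) (fst p), (T ^^ n) (snd p))) -` W"
    obtain x y where xy: "p = (x, y)" by fastforce
    then obtain U where U: "inj_on (T ^^ (m - n)) U" "(T ^^ n) x \<in> U" "(T ^^ n) y \<in> U"
      using p unfolding W_def by auto
    have "(T ^^ m) z = (T ^^ (m - n)) ((T ^^ n) z)" for z
      using \<open>n \<le> m\<close> by (metis comp_apply funpow_add le_add_diff_inverse2)
    then have "(T ^^ (m - n)) ((T ^^ n) x) = (T ^^ (m - n)) ((T ^^ n) y)"
      using p xy by (simp add: tail_rel_level_def)
    then show "p \<in> tail_rel_level T n"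
      using U xy by (simp add: tail_rel_level_def inj_on_eq_iff)
  qed
  ultimately show ?thesis by (metis openin_open_Int)
qed

text \<open>Openness is tested on each \<open>R_m\<close>. If \<open>n \<le> m\<close> the trace is
  \<open>R_n\<close>, open in \<open>R_m\<close>; otherwise \<open>R_m\<close> lies inside
  \<open>R_n\<close> and the trace is all of \<open>R_m\<close>.\<close>

lemma openin_tail_rel_level:
  fixes T :: "'a::t2_space \<Rightarrow> 'a"
  assumes T: "local_homeo T"
  shows "openin (tail_topology T) (tail_rel_level T n)"
  unfolding openin_tail_topology
proof (intro conjI allI)
  fix m
  show "openin (top_of_set (tail_rel_level T m)) (tail_rel_level T n \<inter> tail_rel_level T m)"
  proof (cases "n \<le> m")
    case True
    then show ?thesis
      using openin_tail_rel_level_level[OF T True] tail_rel_level_mono[OF True]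
      by (metis inf.absorb1)
  next
    case False
    then have "tail_rel_level T n \<inter> tail_rel_level T m = tail_rel_level T m"
      using tail_rel_level_mono[of m n T] by auto
    then show ?thesis by simp
  qed
qed (rule tail_rel_level_subset)

lemma closedin_tail_rel_level:
  fixes T :: "'a::t2_space \<Rightarrow> 'a"
  assumes T: "local_homeo T"
  shows "closedin (tail_topology T) (tail_rel_level T n)"
  unfolding closedin_def topspace_tail_topology
proof
  show "openin (tail_topology T) (tail_rel T - tail_rel_level T n)"
    unfolding openin_tail_topology
  proof (intro conjI allI)
    fix m
    have "(tail_rel T - tail_rel_level T n) \<inter> tail_rel_level T m
        = tail_rel_level T m \<inter> - tail_rel_level T n"
      using tail_rel_level_subset by blast
    then show "openin (top_of_set (tail_rel_level T m))
        ((tail_rel T - tail_rel_level T n) \<inter> tail_rel_level T m)"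
      using closed_tail_rel_level[OF T, of n] by (simp add: openin_open_Int open_Compl)
  qed blast
qed (rule tail_rel_level_subset)

text \<open>In the product topology \<open>R_n\<close> is closed in a compact space. Its inclusion
  into the inductive limit is continuous by the very definition of that topology, so the image is
  compact.\<close>

lemma compactin_tail_rel_level:
  fixes T :: "'a::t2_space \<Rightarrow> 'a"
  assumes T: "local_homeo T" and K: "compact (UNIV :: 'a set)"
  shows "compactin (tail_topology T) (tail_rel_level T n)"
proof -
  let ?R = "tail_rel_level T n"
  have "compact ?R"
    using compact_Int_closed[OF compact_UNIV_prod[OF K K] closed_tail_rel_level[OF T]] by simp
  then have "compactin (top_of_set ?R) ?R"
    by (simp add: compactin_subtopology)
  moreover have "continuous_map (top_of_set ?R) (tail_topology T) id"
    unfolding continuous_map topspace_tail_topology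
  proof (intro conjI allI impI)
    fix W assume "openin (tail_topology T) W"
    then have "openin (top_of_set ?R) (W \<inter> ?R)" by (simp add: openin_tail_topology)
    moreover have "{p \<in> topspace (top_of_set ?R). id p \<in> W} = W \<inter> ?R" by auto
    ultimately show "openin (top_of_set ?R) {p \<in> topspace (top_of_set ?R). id p \<in> W}"
      by metis
  qed (simp add: tail_rel_level_subset)
  ultimately show ?thesis using image_compactin by fastforce
qed

text \<open>The open sets \<open>R_n\<close> increase to \<open>R\<close>, so finitely many of them
  cover a compact set and the largest one suffices.\<close>

lemma compactin_tail_topology_imp_level:
  fixes T :: "'a::t2_space \<Rightarrow> 'a"
  assumes T: "local_homeo T" and C: "compactin (tail_topology T) C"
  shows "\<exists>n. C \<subseteq> tail_rel_level T n"
proof -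
  have "C \<subseteq> \<Union>(range (tail_rel_level T))"
    using compactin_subset_topspace[OF C] by (simp add: topspace_tail_topology tail_rel_def)
  then obtain F where F: "finite F" "F \<subseteq> range (tail_rel_level T)" "C \<subseteq> \<Union>F"
    using compactinD[OF C, of "range (tail_rel_level T)"] openin_tail_rel_level[OF T] by blast
  then obtain N where N: "finite N" "F = tail_rel_level T ` N"
    by (meson finite_subset_image)
  \<comment> \<open>Inserting \<open>0\<close> keeps \<open>Max\<close> meaningful when
    \<open>N\<close> is empty.\<close>
  have "C \<subseteq> tail_rel_level T (Max (insert 0 N))"
  proof
    fix p assume "p \<in> C"
    then obtain n where "n \<in> N" "p \<in> tail_rel_level T n" using F N by blast
    moreover have "n \<le> Max (insert 0 N)" using N \<open>n \<in> N\<close> by simp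
    ultimately show "p \<in> tail_rel_level T (Max (insert 0 N))"
      using tail_rel_level_mono by blast
  qed
  then show ?thesis by blast
qed

section \<open>Compactly supported continuous functions on \<open>R\<close>\<close>

lemma tail_Cc_extend_level:
  fixes T :: "'a::t2_space \<Rightarrow> 'a"
  assumes T: "local_homeo T" and K: "compact (UNIV :: 'a set)" and f: "f \<in> tail_Cc T"
  obtains n F where "continuous_on UNIV F"
    and "\<And>p. p \<in> tail_rel_level T n \<Longrightarrow> F p = f p"
    and "\<And>p. p \<in> tail_rel T - tail_rel_level T n \<Longrightarrow> f p = 0"
proof -
  let ?supp = "{p \<in> tail_rel T. f p \<noteq> 0}"
  have cf: "continuous_map (tail_topology T) euclideanreal f"
    and co: "compactin (tail_topology T) (tail_topology T closure_of ?supp)"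
    using f by (auto simp: tail_Cc_def)
  obtain n where n: "tail_topology T closure_of ?supp \<subseteq> tail_rel_level T n"
    using compactin_tail_topology_imp_level[OF T co] by blast
  let ?R = "tail_rel_level T n"
  have "?supp \<subseteq> tail_topology T closure_of ?supp"
    by (rule closure_of_subset) (auto simp: topspace_tail_topology)
  then have zero: "\<And>p. p \<in> tail_rel T - ?R \<Longrightarrow> f p = 0" using n by blast
  have cR: "continuous_map (top_of_set ?R) euclideanreal f"
    unfolding continuous_map
  proof (intro conjI allI impI)
    fix U assume "openin euclideanreal U"
    then have "openin (tail_topology T) {p \<in> tail_rel T. f p \<in> U}"
      using cf by (simp add: continuous_map topspace_tail_topology)
    then have "openin (top_of_set ?R) ({p \<in> tail_rel T. f p \<in> U} \<inter> ?R)"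
      by (simp add: openin_tail_topology)
    moreover have "{p \<in> tail_rel T. f p \<in> U} \<inter> ?R = {p \<in> topspace (top_of_set ?R). f p \<in> U}"
      using tail_rel_level_subset by auto
    ultimately show "openin (top_of_set ?R) {p \<in> topspace (top_of_set ?R). f p \<in> U}" by simp
  qed simp
  \<comment> \<open>Tietze extension from the closed set \<open>R_n\<close> to the whole product:
    the fibre-sum lemmas require a function that is continuous everywhere.\<close>
  obtain F where "continuous_map euclidean euclideanreal F" "\<And>p. p \<in> ?R \<Longrightarrow> F p = f p"
  proof (rule Tietze_extension_realinterval[of euclidean ?R UNIV f])
    show "normal_space (euclidean :: ('a \<times> 'a) topology)"
      by (intro normal_space_euclidean_compact compact_UNIV_prod K)
    show "closedin euclidean ?R" using closed_tail_rel_level[OF T] by simp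
  qed (use cR in auto)
  then show thesis using that[of F n] zero by simp
qed

text \<open>Extension by zero stays continuous because \<open>R_n\<close> is clopen in
  \<open>R\<close>, and the support stays inside the compact set \<open>R_n\<close>. This provides
  the test functions for quasi-invariance.\<close>

lemma tail_Cc_level:
  fixes T :: "'a::t2_space \<Rightarrow> 'a"
  assumes T: "local_homeo T" and K: "compact (UNIV :: 'a set)" and F: "continuous_on UNIV F"
  shows "(\<lambda>p. if p \<in> tail_rel_level T n then F p else 0) \<in> tail_Cc T" (is "?f \<in> _")
proof -
  let ?R = "tail_rel_level T n"
  have "continuous_map (tail_topology T) euclideanreal ?f"
    unfolding continuous_map topspace_tail_topology
  proof (intro conjI allI impI)
    fix U :: "real set" assume "openin euclideanreal U"
    then have FU: "open (F -` U)" using F by (simp add: open_vimage)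
    have 1: "openin (tail_topology T) (?R \<inter> F -` U)"
      unfolding openin_tail_topology
    proof (intro conjI allI)
      fix m
      have "openin (top_of_set (tail_rel_level T m)) ((?R \<inter> tail_rel_level T m)
          \<inter> (tail_rel_level T m \<inter> F -` U))"
        using openin_tail_rel_level[OF T, of n] openin_Int[OF _ openin_open_Int[OF FU]]
        unfolding openin_tail_topology by blast
      then show "openin (top_of_set (tail_rel_level T m)) (?R \<inter> F -` U \<inter> tail_rel_level T m)"
        by (simp add: Int_ac)
    qed (use tail_rel_level_subset in blast)
    have 2: "openin (tail_topology T) (tail_rel T - ?R)"
      using closedin_tail_rel_level[OF T, of n] by (simp add: closedin_def topspace_tail_topology)
    \<comment> \<open>Off \<open>R_n\<close> the function is \<open>0\<close>, so the complement of
      \<open>R_n\<close> belongs to the preimage exactly when \<open>0\<close> lies in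
      \<open>U\<close>.\<close>
    have "{p \<in> tail_rel T. ?f p \<in> U} =
        (?R \<inter> F -` U) \<union> (if 0 \<in> U then tail_rel T - ?R else {})"
      using tail_rel_level_subset[of T n] by auto
    then show "openin (tail_topology T) {p \<in> tail_rel T. ?f p \<in> U}"
      using 1 2 by (auto intro: openin_Un)
  qed simp
  moreover have "compactin (tail_topology T) (tail_topology T closure_of {p \<in> tail_rel T. ?f p \<noteq> 0})"
    by (intro closed_compactin[OF compactin_tail_rel_level[OF T K, of n]] closure_of_minimal
        closedin_tail_rel_level[OF T] closedin_closure_of) auto
  ultimately show ?thesis by (simp add: tail_Cc_def)
qed

section \<open>Iterates of the transfer operator\<close>

definition birkhoff_prod :: "('a \<Rightarrow> 'a) \<Rightarrow> ('a \<Rightarrow> real) \<Rightarrow> nat \<Rightarrow> 'a \<Rightarrow> real" where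
  "birkhoff_prod T g n x = (\<Prod>i<n. g ((T ^^ i) x))"

text \<open>The closed form of the n-th power of L_g, on plain functions. A single sum over a fibre
  of \<open>T ^^ n\<close> is a sum over a class of \<open>R_n\<close>, which is how it meets the
  groupoid; \<open>iter_transfer_Suc\<close> recovers the iteration.\<close>

definition iter_transfer :: "('a \<Rightarrow> 'a) \<Rightarrow> ('a \<Rightarrow> real) \<Rightarrow> nat \<Rightarrow> ('a \<Rightarrow> real) \<Rightarrow> 'a \<Rightarrow> real" where
  "iter_transfer T g n u z = (\<Sum>y | (T ^^ n) y = z. birkhoff_prod T g n y * u y)"

text \<open>Quasi-invariance with all groupoid sums removed; the equivalence is
  \<open>quasi_invariant_iff_transfer_invariant\<close>.\<close>

definition transfer_invariant ::
    "('a::topological_space \<Rightarrow> 'a) \<Rightarrow> ('a \<Rightarrow> real) \<Rightarrow> 'a measure \<Rightarrow> bool" where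
  "transfer_invariant T g \<mu> \<longleftrightarrow> (\<forall>n u v. continuous_on UNIV u \<longrightarrow> continuous_on UNIV v \<longrightarrow>
     iter_transfer T g n u = iter_transfer T g n v \<longrightarrow> (\<integral>x. u x \<partial>\<mu>) = (\<integral>x. v x \<partial>\<mu>))"

lemma transfer_invariantD:
  assumes "transfer_invariant T g \<mu>" "continuous_on UNIV u" "continuous_on UNIV v"
    and "\<And>z. iter_transfer T g n u z = iter_transfer T g n v z"
  shows "(\<integral>x. u x \<partial>\<mu>) = (\<integral>x. v x \<partial>\<mu>)"
  using assms unfolding transfer_invariant_def by blast

lemma birkhoff_prod_Suc: "birkhoff_prod T g (Suc n) y = g y * birkhoff_prod T g n (T y)"
  unfolding birkhoff_prod_def prod.lessThan_Suc_shift by (simp add: funpow_swap1)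

lemma iter_transfer_0: "iter_transfer T g 0 u = u"
proof
  fix z :: 'a
  have "{y. y = z} = {z}" by blast
  then show "iter_transfer T g 0 u z = u z" by (simp add: iter_transfer_def birkhoff_prod_def)
qed

lemma iter_transfer_Suc_0: "iter_transfer T g (Suc 0) u z = (\<Sum>y | T y = z. g y * u y)"
  by (simp add: iter_transfer_def birkhoff_prod_def)

text \<open>A factor pulled back along \<open>T ^^ n\<close> is constant on the fibre over
  \<open>z\<close> and leaves the sum. This underlies the right inverse of L_g in
  \<open>transfer_quotient\<close>.\<close>

lemma iter_transfer_mult_comp:
  "iter_transfer T g n (\<lambda>y. w ((T ^^ n) y) * u y) z = w z * iter_transfer T g n u z"
  unfolding iter_transfer_def sum_distrib_left by (rule sum.cong) auto

section \<open>Integrals of continuous functions against Borel probability measures\<close>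

lemma borel_measurable_continuous_prob:
  assumes "is_borel_prob \<mu>" and "continuous_on UNIV u"
  shows "u \<in> borel_measurable \<mu>"
  using assms borel_measurable_continuous_onI measurable_cong_sets
  unfolding is_borel_prob_def by blast

lemma integrable_continuous_prob:
  fixes u :: "'a::topological_space \<Rightarrow> real"
  assumes K: "compact (UNIV :: 'a set)" and \<mu>: "is_borel_prob \<mu>" and u: "continuous_on UNIV u"
  shows "integrable \<mu> u"
proof -
  interpret prob_space \<mu> using \<mu> by (simp add: is_borel_prob_def)
  obtain B where "\<And>x. norm (u x) \<le> B"
    using compact_imp_bounded[OF compact_continuous_image[OF u K]] by (auto simp: bounded_iff)
  then show ?thesis
    by (intro integrable_const_bound[where B = B] borel_measurable_continuous_prob[OF \<mu> u]) simp
qed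

text \<open>By compactness \<open>u\<close> attains its minimum; this positive number bounds the
  integral from below, the total mass being 1.\<close>

lemma integral_continuous_prob_pos:
  fixes u :: "'a::topological_space \<Rightarrow> real"
  assumes K: "compact (UNIV :: 'a set)" and \<mu>: "is_borel_prob \<mu>" and u: "continuous_on UNIV u"
    and pos: "\<And>x. 0 < u x"
  shows "0 < (\<integral>x. u x \<partial>\<mu>)"
proof -
  interpret prob_space \<mu> using \<mu> by (simp add: is_borel_prob_def)
  obtain x where x: "\<And>y. u x \<le> u y"
    using continuous_attains_inf[OF K _ u] by auto
  have "u x \<le> (\<integral>x. u x \<partial>\<mu>)"
    by (rule integral_ge_const[OF integrable_continuous_prob[OF K \<mu> u]]) (simp add: x)
  then show ?thesis using pos[of x] by linarith
qed

section \<open>Continuity, positivity and composition of the iterated operators\<close>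

locale transfer_system =
  fixes T :: "'a::t2_space \<Rightarrow> 'a" and g :: "'a \<Rightarrow> real"
  assumes compact: "compact (UNIV :: 'a set)"
    and local_homeo: "local_homeo T"
    and surj: "surj T"
    and cont: "continuous_on UNIV g"
    and pos: "0 < g x"
begin

abbreviation "S \<equiv> birkhoff_prod T g"
abbreviation "L \<equiv> iter_transfer T g"

lemmas local_homeo_pow = local_homeo_funpow[OF local_homeo]
lemmas continuous_pow = local_homeo_continuous[OF local_homeo_pow]
lemmas continuous_T = local_homeo_continuous[OF local_homeo]

lemma finite_fibre: "finite {y. (T ^^ n) y = z}"
  by (rule local_homeo_finite_fibre[OF local_homeo_pow compact])

lemma continuous_birkhoff_prod: "continuous_on UNIV (S n)"
proof -
  have "continuous_on UNIV (\<lambda>x. \<Prod>i<n. g ((T ^^ i) x))"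
    by (intro continuous_on_prod continuous_on_compose2[OF cont continuous_pow]) simp
  then show ?thesis by (simp add: birkhoff_prod_def[abs_def])
qed

lemma birkhoff_prod_pos: "0 < S n x"
  by (simp add: birkhoff_prod_def prod_pos pos)

lemma birkhoff_prod_neq_0: "S n x \<noteq> 0"
  using birkhoff_prod_pos[of n x] by simp

lemma continuous_iter_transfer:
  assumes "continuous_on UNIV u"
  shows "continuous_on UNIV (L n u)"
proof -
  have "continuous_on UNIV (\<lambda>z. L n u z)"
    unfolding iter_transfer_def
    by (intro continuous_on_fibre_sum local_homeo_pow compact continuous_on_mult
        continuous_birkhoff_prod assms)
  then show ?thesis .
qed

text \<open>Surjectivity makes every fibre nonempty and every summand is positive. All later
  divisions by \<open>L n (\<lambda>_. 1)\<close> rest on this.\<close>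

lemma iter_transfer_1_pos: "0 < L n (\<lambda>_. 1) z"
proof -
  obtain y where "(T ^^ n) y = z" using surj_fn[OF surj, of n] by (metis surjD)
  then have "{y. (T ^^ n) y = z} \<noteq> {}" by blast
  then show ?thesis
    by (simp add: iter_transfer_def sum_pos finite_fibre birkhoff_prod_pos)
qed

text \<open>The fibre of \<open>T ^^ Suc n\<close> over \<open>z\<close> is grouped by the value
  \<open>w = T y\<close>, which runs through the fibre of \<open>T ^^ n\<close>. The single step is
  innermost, so that it can be cancelled or integrated first.\<close>

lemma iter_transfer_Suc: "L (Suc n) u = L n (L (Suc 0) u)"
proof
  fix z
  let ?F = "\<lambda>y. S (Suc n) y * u y"
  have pow: "(T ^^ Suc n) y = (T ^^ n) (T y)" for y by (simp add: funpow_swap1)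
  have "L (Suc n) u z = (\<Sum>w | (T ^^ n) w = z. \<Sum>y\<in>{y \<in> {y. (T ^^ Suc n) y = z}. T y = w}. ?F y)"
    unfolding iter_transfer_def
    by (rule sum.group[symmetric, OF finite_fibre finite_fibre]) (use pow in auto)
  also have "\<dots> = (\<Sum>w | (T ^^ n) w = z. S n w * (\<Sum>y | T y = w. g y * u y))"
  proof (rule sum.cong[OF refl])
    fix w assume "w \<in> {w. (T ^^ n) w = z}"
    then have "{y \<in> {y. (T ^^ Suc n) y = z}. T y = w} = {y. T y = w}" using pow by auto
    then show "(\<Sum>y\<in>{y \<in> {y. (T ^^ Suc n) y = z}. T y = w}. ?F y)
        = S n w * (\<Sum>y | T y = w. g y * u y)"
      by (auto simp: sum_distrib_left birkhoff_prod_Suc mult_ac intro!: sum.cong)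
  qed
  finally show "L (Suc n) u z = L n (L (Suc 0) u) z"
    by (simp add: iter_transfer_def[of T g n] iter_transfer_Suc_0)
qed

section \<open>Quasi-invariance in terms of the iterated operators\<close>

lemma infsum_tail_left:
  assumes "\<forall>p\<in>tail_rel T - tail_rel_level T n. f p = 0"
  shows "(\<Sum>\<^sub>\<infinity>y\<in>{y. (x, y) \<in> tail_rel T}. f (x, y)) = (\<Sum>y | (T ^^ n) y = (T ^^ n) x. f (x, y))"
proof -
  have "(\<Sum>\<^sub>\<infinity>y\<in>{y. (x, y) \<in> tail_rel T}. f (x, y))
      = (\<Sum>\<^sub>\<infinity>y\<in>{y. (T ^^ n) y = (T ^^ n) x}. f (x, y))"
    using assms tail_rel_level_subset[of T n]
    by (intro infsum_cong_neutral) (auto simp: tail_rel_level_iff tail_relI[where n = n])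
  \<comment> \<open>A full class of \<open>R\<close> may be infinite; only the restriction to one
    fibre of \<open>T ^^ n\<close> makes the sum finite.\<close>
  then show ?thesis by (simp add: finite_fibre)
qed

lemma infsum_tail_right:
  assumes "\<forall>p\<in>tail_rel T - tail_rel_level T n. f p = 0"
  shows "(\<Sum>\<^sub>\<infinity>x\<in>{x. (x, y) \<in> tail_rel T}. f (x, y) * tail_cocycle T g (x, y))
    = (\<Sum>x | (T ^^ n) x = (T ^^ n) y. f (x, y) * (S n x / S n y))"
proof -
  have "(\<Sum>\<^sub>\<infinity>x\<in>{x. (x, y) \<in> tail_rel T}. f (x, y) * tail_cocycle T g (x, y))
      = (\<Sum>\<^sub>\<infinity>x\<in>{x. (T ^^ n) x = (T ^^ n) y}. f (x, y) * (S n x / S n y))"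
  proof (rule infsum_cong_neutral)
    fix x assume x: "x \<in> {x. (x, y) \<in> tail_rel T} \<inter> {x. (T ^^ n) x = (T ^^ n) y}"
    have "g x \<noteq> 0" for x using pos[of x] by simp
    then show "f (x, y) * tail_cocycle T g (x, y) = f (x, y) * (S n x / S n y)"
      using x tail_cocycle_eq[where g = g and T = T and n = n and x = x and y = y] by (simp add: birkhoff_prod_def)
  qed (use assms tail_rel_level_subset[of T n] in \<open>auto simp: tail_rel_level_iff tail_relI[where n = n]\<close>)
  then show ?thesis by (simp add: finite_fibre)
qed

text \<open>Quasi-invariance is tested on the functions supported in \<open>R\<^sub>n\<close> that depend on the second
  variable only; this says that \<open>\<mu>\<close> disintegrates along \<open>T ^^ n\<close> with weights proportional
  to \<open>S n\<close>.\<close>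

lemma quasi_invariant_average:
  assumes q: "quasi_invariant T (tail_cocycle T g) \<mu>" and u: "continuous_on UNIV u"
  shows "(\<integral>x. u x \<partial>\<mu>) = (\<integral>x. L n u ((T ^^ n) x) / L n (\<lambda>_. 1) ((T ^^ n) x) \<partial>\<mu>)"
proof -
  let ?Z = "L n (\<lambda>_. 1)"
  \<comment> \<open>Solves for the weight whose right-hand sum is \<open>u\<close>: summing
    \<open>w y * S n x / S n y\<close> over the class of \<open>y\<close> gives
    \<open>w y / S n y * ?Z ((T ^^ n) y)\<close>.\<close>
  define w where "w y = u y * S n y / ?Z ((T ^^ n) y)" for y
  have Z: "?Z z \<noteq> 0" for z using iter_transfer_1_pos[of n z] by simp
  have cZ: "continuous_on UNIV (\<lambda>y. ?Z ((T ^^ n) y))"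
    by (rule continuous_on_compose2[OF continuous_iter_transfer continuous_pow]) auto
  have w: "continuous_on UNIV w"
    unfolding w_def by (intro continuous_on_divide continuous_on_mult u continuous_birkhoff_prod cZ)
      (simp add: Z)
  define f where "f p = (if p \<in> tail_rel_level T n then w (snd p) else 0)" for p
  have fCc: "f \<in> tail_Cc T"
    unfolding f_def
    by (intro tail_Cc_level[OF local_homeo compact] continuous_on_compose2[OF w] continuous_intros) auto
  have f0: "\<forall>p\<in>tail_rel T - tail_rel_level T n. f p = 0"
    by (simp add: f_def)
  have eq: "(\<integral>x. (\<Sum>y | (T ^^ n) y = (T ^^ n) x. f (x, y)) \<partial>\<mu>)
      = (\<integral>y. (\<Sum>x | (T ^^ n) x = (T ^^ n) y. f (x, y) * (S n x / S n y)) \<partial>\<mu>)"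
    using bspec[OF q[unfolded quasi_invariant_def] fCc]
    unfolding infsum_tail_left[OF f0] infsum_tail_right[OF f0] .
  have "(\<Sum>y | (T ^^ n) y = (T ^^ n) x. f (x, y)) = L n u ((T ^^ n) x) / ?Z ((T ^^ n) x)" for x
    unfolding iter_transfer_def[of T g n u] sum_divide_distrib
    by (rule sum.cong) (auto simp: f_def w_def tail_rel_level_iff)
  moreover have "(\<Sum>x | (T ^^ n) x = (T ^^ n) y. f (x, y) * (S n x / S n y)) = u y" for y
  proof -
    have "(\<Sum>x | (T ^^ n) x = (T ^^ n) y. f (x, y) * (S n x / S n y))
        = (\<Sum>x | (T ^^ n) x = (T ^^ n) y. w y / S n y * (S n x * 1))"
      by (rule sum.cong) (auto simp: f_def tail_rel_level_iff)
    also have "\<dots> = w y / S n y * ?Z ((T ^^ n) y)"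
      by (simp only: iter_transfer_def sum_distrib_left)
    also have "\<dots> = u y"
      using Z[of "(T ^^ n) y"] birkhoff_prod_neq_0[of n y] by (simp add: w_def)
    finally show ?thesis .
  qed
  ultimately show ?thesis using eq by simp
qed

text \<open>From left to right, the averaging formula expresses the integral of \<open>u\<close>
  through \<open>L n u\<close> alone. From right to left, a test function lives on some
  \<open>R_n\<close>, and the two integrands are continuous functions with the same image under
  \<open>L n\<close>.\<close>

lemma quasi_invariant_iff_transfer_invariant:
  "quasi_invariant T (tail_cocycle T g) \<mu> \<longleftrightarrow> transfer_invariant T g \<mu>"
proof
  assume q: "quasi_invariant T (tail_cocycle T g) \<mu>"
  show "transfer_invariant T g \<mu>"
    unfolding transfer_invariant_def
  proof (intro allI impI)
    fix n u v
    assume "continuous_on UNIV u" "continuous_on UNIV v" "L n u = L n v"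
    then show "(\<integral>x. u x \<partial>\<mu>) = (\<integral>x. v x \<partial>\<mu>)"
      using quasi_invariant_average[OF q, of u n] quasi_invariant_average[OF q, of v n] by simp
  qed
next
  assume inv: "transfer_invariant T g \<mu>"
  show "quasi_invariant T (tail_cocycle T g) \<mu>"
    unfolding quasi_invariant_def
  proof
    fix f assume "f \<in> tail_Cc T"
    then obtain n F where F: "continuous_on UNIV F"
      and Ff: "\<And>p. p \<in> tail_rel_level T n \<Longrightarrow> F p = f p"
      and f0: "\<forall>p\<in>tail_rel T - tail_rel_level T n. f p = 0"
      by (rule tail_Cc_extend_level[OF local_homeo compact]) blast
    \<comment> \<open>\<open>A\<close> and \<open>B\<close> are the two integrands of
      quasi-invariance, written with the global extension \<open>F\<close> so that they are
      continuous on all of X.\<close>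
    define A where "A x = (\<Sum>y | (T ^^ n) y = (T ^^ n) x. F (x, y))" for x
    define B where "B y = (\<Sum>x | (T ^^ n) x = (T ^^ n) y. F (x, y) * (S n x / S n y))" for y
    have "continuous_on UNIV A"
      unfolding A_def[abs_def]
      by (rule continuous_on_fibre_sum_param[OF local_homeo_pow compact compact F continuous_pow])
    moreover have "continuous_on UNIV B"
    proof -
      \<comment> \<open>The coordinates are swapped because
        \<open>continuous_on_fibre_sum_param\<close> sums over the second one, while
        \<open>B\<close> sums over the first argument of \<open>F\<close>.\<close>
      let ?h = "\<lambda>p. F (snd p, fst p) * (S n (snd p) / S n (fst p))"
      have "continuous_on UNIV ?h"
        by (intro continuous_on_mult continuous_on_divide continuous_on_compose2[OF F]
            continuous_on_compose2[OF continuous_birkhoff_prod] continuous_intros)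
          (auto simp: birkhoff_prod_neq_0)
      then show ?thesis
        using continuous_on_fibre_sum_param[OF local_homeo_pow compact compact _ continuous_pow,
            of ?h n n]
        by (simp add: B_def[abs_def])
    qed
    \<comment> \<open>Both sides are the sum of \<open>S n x * F (x, y)\<close> over pairs in the
      fibre over \<open>z\<close>; in \<open>L n B\<close> the weight \<open>S n y\<close> cancels
      the denominator of the cocycle.\<close>
    moreover have "L n A z = L n B z" for z
    proof -
      have "L n A z = (\<Sum>x | (T ^^ n) x = z. \<Sum>y | (T ^^ n) y = z. S n x * F (x, y))"
        unfolding iter_transfer_def A_def by (rule sum.cong) (auto simp: sum_distrib_left)
      also have "\<dots> = (\<Sum>y | (T ^^ n) y = z. \<Sum>x | (T ^^ n) x = z. S n x * F (x, y))"
        by (rule sum.swap)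
      also have "\<dots> = L n B z"
        unfolding iter_transfer_def B_def
        by (rule sum.cong) (auto simp: sum_distrib_left birkhoff_prod_neq_0 intro!: sum.cong)
      finally show ?thesis .
    qed
    ultimately have "(\<integral>x. A x \<partial>\<mu>) = (\<integral>x. B x \<partial>\<mu>)" by (rule transfer_invariantD[OF inv])
    moreover have "(\<Sum>\<^sub>\<infinity>y\<in>{y. (x, y) \<in> tail_rel T}. f (x, y)) = A x" for x
      unfolding infsum_tail_left[OF f0] A_def
      by (rule sum.cong) (auto simp: Ff tail_rel_level_iff)
    moreover have "(\<Sum>\<^sub>\<infinity>x\<in>{x. (x, y) \<in> tail_rel T}. f (x, y) * tail_cocycle T g (x, y)) = B y" for y
      unfolding infsum_tail_right[OF f0] B_def
      by (rule sum.cong) (auto simp: Ff tail_rel_level_iff)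
    ultimately show "(\<integral>x. (\<Sum>\<^sub>\<infinity>y\<in>{y. (x, y) \<in> tail_rel T}. f (x, y)) \<partial>\<mu>) =
       (\<integral>y. (\<Sum>\<^sub>\<infinity>x\<in>{x. (x, y) \<in> tail_rel T}. f (x, y) * tail_cocycle T g (x, y)) \<partial>\<mu>)"
      by simp
  qed
qed

section \<open>Eigenmeasures\<close>

text \<open>Passes from functionals on C(X) to integrals of plain functions: by compactness every
  continuous function is bounded and so comes from the function space type.\<close>

lemma eigenmeasure_iff:
  assumes \<mu>: "is_borel_prob \<mu>"
  shows "transpose_op (transfer_op T g) (prob_functional \<mu>) = c *\<^sub>R prob_functional \<mu> \<longleftrightarrow>
    (\<forall>u. continuous_on UNIV u \<longrightarrow> (\<integral>x. L (Suc 0) u x \<partial>\<mu>) = c * (\<integral>x. u x \<partial>\<mu>))"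
    (is "?E \<longleftrightarrow> ?I")
proof -
  have lhs: "blinfun_apply (transpose_op (transfer_op T g) (prob_functional \<mu>)) f
      = (\<integral>x. L (Suc 0) (apply_bcontfun f) x \<partial>\<mu>)" for f
    by (simp add: transpose_op_def blinfun_compose.rep_eq prob_functional_apply[OF \<mu>]
        transfer_op_apply[OF local_homeo compact cont] iter_transfer_Suc_0)
  have rhs: "blinfun_apply (c *\<^sub>R prob_functional \<mu>) f = c * (\<integral>x. apply_bcontfun f x \<partial>\<mu>)" for f
    by (simp add: scaleR_blinfun.rep_eq prob_functional_apply[OF \<mu>])
  show ?thesis
  proof
    assume E: ?E
    show ?I
    proof (intro allI impI)
      fix u :: "'a \<Rightarrow> real" assume u: "continuous_on UNIV u"
      then have "u \<in> bcontfun"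
        using compact_imp_bounded[OF compact_continuous_image[OF u compact]]
        by (simp add: bcontfun_def)
      then show "(\<integral>x. L (Suc 0) u x \<partial>\<mu>) = c * (\<integral>x. u x \<partial>\<mu>)"
        using E lhs[of "Bcontfun u"] rhs[of "Bcontfun u"] by (simp add: Bcontfun_inverse)
    qed
  next
    assume I: ?I
    show ?E
    proof (rule blinfun_eqI)
      fix f :: "'a \<Rightarrow>\<^sub>C real"
      have "continuous_on UNIV (apply_bcontfun f)" by simp
      then show "blinfun_apply (transpose_op (transfer_op T g) (prob_functional \<mu>)) f
          = blinfun_apply (c *\<^sub>R prob_functional \<mu>) f"
        unfolding lhs rhs using I by blast
    qed
  qed
qed

lemma eigenmeasure_transfer_invariant:
  assumes \<mu>: "is_borel_prob \<mu>"
    and eig: "\<And>u. continuous_on UNIV u \<Longrightarrow> (\<integral>x. L (Suc 0) u x \<partial>\<mu>) = c * (\<integral>x. u x \<partial>\<mu>)"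
  shows "transfer_invariant T g \<mu>"
proof -
  interpret prob_space \<mu> using \<mu> by (simp add: is_borel_prob_def)
  \<comment> \<open>Testing on the constant 1 identifies \<open>c\<close> as a positive integral, so
    that \<open>c ^ n\<close> can be cancelled at the end.\<close>
  have "0 < (\<integral>x. L (Suc 0) (\<lambda>_. 1) x \<partial>\<mu>)"
    by (rule integral_continuous_prob_pos[OF compact \<mu> continuous_iter_transfer iter_transfer_1_pos]) simp
  also have "\<dots> = c" using eig[of "\<lambda>_. 1"] by (simp add: prob_space)
  finally have c: "c \<noteq> 0" by simp
  have pow: "(\<integral>x. L n u x \<partial>\<mu>) = c ^ n * (\<integral>x. u x \<partial>\<mu>)" if "continuous_on UNIV u" for n u
    using that
  \<comment> \<open>The induction hypothesis is applied to \<open>L (Suc 0) u\<close>, hence the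
    generalization over \<open>u\<close>.\<close>
  proof (induction n arbitrary: u)
    case (Suc n)
    then show ?case
      using eig[of u] by (simp add: iter_transfer_Suc[of n u] continuous_iter_transfer)
  qed (simp add: iter_transfer_0)
  show ?thesis
    unfolding transfer_invariant_def
  proof (intro allI impI)
    fix n u v
    assume "continuous_on UNIV u" "continuous_on UNIV v" "L n u = L n v"
    then show "(\<integral>x. u x \<partial>\<mu>) = (\<integral>x. v x \<partial>\<mu>)"
      using pow[of u n] pow[of v n] c by simp
  qed
qed

section \<open>The normalized push-forward of a measure\<close>

definition normalizer :: "'a measure \<Rightarrow> real" where
  "normalizer \<mu> = (\<integral>x. 1 / L (Suc 0) (\<lambda>_. 1) (T x) \<partial>\<mu>)"

text \<open>\<open>normalizer \<mu>\<close> is the mass of the push-forward of \<open>\<mu>\<close>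
  with density 1 / L_g 1, written as an integral over \<open>\<mu>\<close>. Its reciprocal becomes
  the eigenvalue.\<close>

definition pushed :: "'a measure \<Rightarrow> 'a measure" where
  "pushed \<mu> = density (distr \<mu> borel T)
     (\<lambda>z. ennreal (1 / (normalizer \<mu> * L (Suc 0) (\<lambda>_. 1) z)))"

context
  fixes \<mu> :: "'a measure"
  assumes \<mu>: "is_borel_prob \<mu>"
begin

lemma continuous_inverse_transfer_1:
  "continuous_on UNIV (\<lambda>z. 1 / L (Suc 0) (\<lambda>_. 1) z)"
  by (intro continuous_on_divide continuous_iter_transfer continuous_on_const)
    (metis iter_transfer_1_pos less_irrefl)

lemma continuous_inverse_transfer_1_comp:
  "continuous_on UNIV (\<lambda>x. 1 / L (Suc 0) (\<lambda>_. 1) (T x))"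
  by (rule continuous_on_compose2[OF continuous_inverse_transfer_1 continuous_T]) simp

lemma normalizer_pos: "0 < normalizer \<mu>"
  unfolding normalizer_def
  by (rule integral_continuous_prob_pos[OF compact \<mu> continuous_inverse_transfer_1_comp])
    (simp add: iter_transfer_1_pos)

lemma density_pushed:
  "(\<lambda>z. 1 / (normalizer \<mu> * L (Suc 0) (\<lambda>_. 1) z)) \<in> borel_measurable borel"
  "0 \<le> 1 / (normalizer \<mu> * L (Suc 0) (\<lambda>_. 1) z)"
proof -
  have "continuous_on UNIV (\<lambda>z. 1 / normalizer \<mu> * (1 / L (Suc 0) (\<lambda>_. 1) z))"
    by (intro continuous_on_mult continuous_inverse_transfer_1 continuous_on_const)
  then show "(\<lambda>z. 1 / (normalizer \<mu> * L (Suc 0) (\<lambda>_. 1) z)) \<in> borel_measurable borel"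
    by (intro borel_measurable_continuous_onI) simp
  show "0 \<le> 1 / (normalizer \<mu> * L (Suc 0) (\<lambda>_. 1) z)"
    using normalizer_pos iter_transfer_1_pos[of "Suc 0" z] by simp
qed

lemma measurable_T: "T \<in> measurable \<mu> borel"
  using borel_measurable_continuous_onI[OF continuous_T] \<mu> measurable_cong_sets
  unfolding is_borel_prob_def by blast

lemma is_borel_prob_pushed: "is_borel_prob (pushed \<mu>)"
proof -
  let ?d = "\<lambda>z. 1 / (normalizer \<mu> * L (Suc 0) (\<lambda>_. 1) z)"
  have d: "?d (T x) = 1 / normalizer \<mu> * (1 / L (Suc 0) (\<lambda>_. 1) (T x))" for x by simp
  have "emeasure (pushed \<mu>) (space (pushed \<mu>)) = (\<integral>\<^sup>+z. ennreal (?d z) \<partial>distr \<mu> borel T)"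
    using density_pushed(1) by (simp add: pushed_def emeasure_density)
  also have "\<dots> = (\<integral>\<^sup>+x. ennreal (?d (T x)) \<partial>\<mu>)"
    using density_pushed(1) by (intro nn_integral_distr measurable_T) simp
  also have "\<dots> = ennreal (\<integral>x. ?d (T x) \<partial>\<mu>)"
  proof (rule nn_integral_eq_integral)
    show "integrable \<mu> (\<lambda>x. ?d (T x))"
      unfolding d
      by (intro integrable_mult_right integrable_continuous_prob[OF compact \<mu>]
          continuous_inverse_transfer_1_comp)
  qed (intro AE_I2 density_pushed(2))
  also have "(\<integral>x. ?d (T x) \<partial>\<mu>) = 1"
    unfolding d integral_mult_right_zero using normalizer_pos by (simp add: normalizer_def)
  finally show ?thesis
    by (auto simp: is_borel_prob_def pushed_def intro!: prob_spaceI)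
qed

text \<open>Unfolds the density and changes variables along \<open>T\<close>, so that all later work
  with \<open>pushed \<mu>\<close> takes place under \<open>\<mu>\<close>.\<close>

lemma integral_pushed:
  assumes u: "continuous_on UNIV u"
  shows "(\<integral>x. u x \<partial>pushed \<mu>) = 1 / normalizer \<mu> * (\<integral>x. u (T x) / L (Suc 0) (\<lambda>_. 1) (T x) \<partial>\<mu>)"
proof -
  let ?d = "\<lambda>z. 1 / (normalizer \<mu> * L (Suc 0) (\<lambda>_. 1) z)"
  have mu: "u \<in> borel_measurable borel" by (rule borel_measurable_continuous_onI[OF u])
  have "(\<integral>x. u x \<partial>pushed \<mu>) = (\<integral>z. ?d z *\<^sub>R u z \<partial>distr \<mu> borel T)"
    unfolding pushed_def using mu density_pushed by (intro integral_density) auto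
  also have "\<dots> = (\<integral>x. ?d (T x) *\<^sub>R u (T x) \<partial>\<mu>)"
    using mu density_pushed(1) by (intro integral_distr measurable_T borel_measurable_scaleR)
  also have "\<dots> = (\<integral>x. 1 / normalizer \<mu> * (u (T x) / L (Suc 0) (\<lambda>_. 1) (T x)) \<partial>\<mu>)"
    by simp
  finally show ?thesis by (simp only: integral_mult_right_zero)
qed

lemma continuous_quotient:
  assumes u: "continuous_on UNIV u"
  shows "continuous_on UNIV (\<lambda>x. u (T x) / L (Suc 0) (\<lambda>_. 1) (T x))"
  using continuous_on_mult[OF continuous_on_compose2[OF u continuous_T] continuous_inverse_transfer_1_comp]
  by simp

text \<open>The pulled-back factor u / L_g 1 leaves the sum and multiplies L_g 1. Thus L_g has an
  explicit right inverse.\<close>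

lemma transfer_quotient:
  "L (Suc 0) (\<lambda>x. u (T x) / L (Suc 0) (\<lambda>_. 1) (T x)) = u"
proof
  show "L (Suc 0) (\<lambda>x. u (T x) / L (Suc 0) (\<lambda>_. 1) (T x)) z = u z" for z
    using iter_transfer_mult_comp[of T g "Suc 0" "\<lambda>z. u z / L (Suc 0) (\<lambda>_. 1) z" "\<lambda>_. 1" z]
      iter_transfer_1_pos[of "Suc 0" z] by simp
qed

lemma transfer_invariant_pushed:
  assumes inv: "transfer_invariant T g \<mu>"
  shows "transfer_invariant T g (pushed \<mu>)"
  unfolding transfer_invariant_def
proof (intro allI impI)
  fix n u v
  assume u: "continuous_on UNIV u" and v: "continuous_on UNIV v" and eq: "L n u = L n v"
  \<comment> \<open>The innermost application of L_g undoes the quotient and leaves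
    \<open>L n u\<close> and \<open>L n v\<close>. Invariance of \<open>pushed \<mu>\<close> at
    level \<open>n\<close> thus comes from that of \<open>\<mu>\<close> at level
    \<open>Suc n\<close>.\<close>
  have "L (Suc n) (\<lambda>x. u (T x) / L (Suc 0) (\<lambda>_. 1) (T x)) z
      = L (Suc n) (\<lambda>x. v (T x) / L (Suc 0) (\<lambda>_. 1) (T x)) z" for z
    using eq by (simp add: iter_transfer_Suc[of n] transfer_quotient)
  then have "(\<integral>x. u (T x) / L (Suc 0) (\<lambda>_. 1) (T x) \<partial>\<mu>)
      = (\<integral>x. v (T x) / L (Suc 0) (\<lambda>_. 1) (T x) \<partial>\<mu>)"
    by (rule transfer_invariantD[OF inv continuous_quotient[OF u] continuous_quotient[OF v]])
  then show "(\<integral>x. u x \<partial>pushed \<mu>) = (\<integral>x. v x \<partial>pushed \<mu>)"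
    by (simp add: integral_pushed u v)
qed

text \<open>\<open>u\<close> and (L_g u / L_g 1) composed with \<open>T\<close> have the same image
  under L_g, so invariance of \<open>\<mu>\<close> at level 1 equates their integrals. Once
  \<open>pushed \<mu>\<close> equals \<open>\<mu>\<close>, this is the eigenvalue equation.\<close>

lemma integral_transfer_pushed:
  assumes inv: "transfer_invariant T g \<mu>" and u: "continuous_on UNIV u"
  shows "(\<integral>x. L (Suc 0) u x \<partial>pushed \<mu>) = 1 / normalizer \<mu> * (\<integral>x. u x \<partial>\<mu>)"
  unfolding integral_pushed[OF continuous_iter_transfer[OF u]]
  using transfer_invariantD[OF inv continuous_quotient[OF continuous_iter_transfer[OF u]] u, of "Suc 0"]
  by (simp add: transfer_quotient)

end

end

theorem proposition7p2:
  fixes T :: "'a::{second_countable_topology, t2_space} \<Rightarrow> 'a"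
    and g :: "'a \<Rightarrow> real"
  assumes "compact (UNIV :: 'a set)"
    and "local_homeo T"
    and "surj T"
    and "continuous_on UNIV g"
    and "\<And>x. 0 < g x"
    and "uniquely_ergodic T (tail_cocycle T g)"
  shows "\<exists>!\<mu>. is_borel_prob \<mu> \<and>
    (\<exists>c::real. transpose_op (transfer_op T g) (prob_functional \<mu>) = c *\<^sub>R prob_functional \<mu>)"
proof -
  interpret transfer_system T g by unfold_locales (use assms in auto)
  have "\<exists>!\<mu>. is_borel_prob \<mu> \<and> transfer_invariant T g \<mu>"
    using assms(6) by (simp add: uniquely_ergodic_def quasi_invariant_iff_transfer_invariant)
  then obtain \<mu> where \<mu>: "is_borel_prob \<mu>" "transfer_invariant T g \<mu>"
    and uniq: "\<And>\<nu>. is_borel_prob \<nu> \<Longrightarrow> transfer_invariant T g \<nu> \<Longrightarrow> \<nu> = \<mu>"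
    by blast
  \<comment> \<open>Unique ergodicity yields existence here: \<open>pushed \<mu>\<close> is another
    invariant probability measure.\<close>
  have "pushed \<mu> = \<mu>"
    by (intro uniq is_borel_prob_pushed transfer_invariant_pushed \<mu>)
  then have "transpose_op (transfer_op T g) (prob_functional \<mu>)
      = (1 / normalizer \<mu>) *\<^sub>R prob_functional \<mu>"
    unfolding eigenmeasure_iff[OF \<mu>(1)] using integral_transfer_pushed[OF \<mu>] by metis
  \<comment> \<open>Uniqueness holds across all eigenvalues: an eigenmeasure for any
    \<open>c\<close> is invariant and hence equal to \<open>\<mu>\<close>.\<close>
  moreover have "\<nu> = \<mu>" if "is_borel_prob \<nu>"
    "transpose_op (transfer_op T g) (prob_functional \<nu>) = c *\<^sub>R prob_functional \<nu>" for \<nu> c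
    using that eigenmeasure_transfer_invariant uniq unfolding eigenmeasure_iff[OF that(1)] by blast
  ultimately show ?thesis using \<mu>(1) by blast
qed

end
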